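(* Let $P=(P_{ij})_{0\le i,j\le d}$ be the eigenmatrix of a distance-regular graph with classical parameters $(d,b,\alpha,\beta)$. Then for $0\le j\le d$, $$P_{dj} = (-1)^j \genfrac{[}{]}{0pt}{}{d}{j}_b\, b^{\binom{j}{2}}.$$
   Context: For a constant $b$ define $\genfrac{[}{]}{0pt}{}{n}{m} = \genfrac{[}{]}{0pt}{}{n}{m}_b$ to be $0$ if $m<0$, $\binom{n}{m}$ if $b=1$, and $\prod_{h=0}^{m-1}\frac{b^{n-h}-1}{b^{m-h}-1}$ otherwise. A graph with classical parameters $(d,b,\alpha,\beta)$ is a distance-regular graph of diameter $d$ with intersection numbers $$b_i = \left(\genfrac{[}{]}{0pt}{}{d}{1} - \genfrac{[}{]}{0pt}{}{i}{1}\right)\left(\beta - \alpha \genfrac{[}{]}{0pt}{}{i}{1}\right),\qquad c_i = \genfrac{[}{]}{0pt}{}{i}{1}\left(1 + \alpha\genfrac{[}{]}{0pt}{}{i-1}{1}\right)\qquad (0\le i\le d).$$ Its valency is $k = b_0 = \beta\genfrac{[}{]}{0pt}{}{d}{1}$, and $a_i = k-b_i-c_i$. It is known that $b$ is an integer different from $0$ and $-1$. The eigenvalues are $\theta_i = \genfrac{[}{]}{0pt}{}{d-i}{1}\left(\beta - \alpha\genfrac{[}{]}{0pt}{}{i}{1}\right) - \genfrac{[}{]}{0pt}{}{i}{1}$ ($0\le i\le d$). The eigenmatrix $P$ is given by $P_{i0}=1$, $P_{i1}=\theta_i$ and $P_{i,j+1} = \left((\theta_i - a_j) P_{ij} - b_{j-1}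 P_{i,j-1}\right)/c_{j+1}$ for $1\le j\le d-1$. *)

theory Defs
  imports Complex_Main "Graph_Theory.Graph_Theory"
begin

text \<open>The brackets [n; m] with base \<open>b\<close>. The arguments are integers because c_0 mentions [-1; 1].\<close>

definition gauss_binomial :: "real \<Rightarrow> int \<Rightarrow> int \<Rightarrow> real" where
  "gauss_binomial b n m =
    (if m < 0 then 0
     else if b = 1 then of_int n gchoose nat m
     else \<Prod>h<nat m. (b powi (n - int h) - 1) / (b powi (m - int h) - 1))"

text \<open>
  Finite simple graphs are the locale \<^locale>\<open>pair_graph\<close>. An undirected edge is a pair of
  opposite arcs, so the neighbours of \<open>v\<close> are the \<open>w\<close> with \<open>(v, w) \<in> parcs G\<close>.
  The distance is only meaningful for connected graphs.
\<close>

definition graph_dist :: "'a pair_pre_digraph \<Rightarrow> 'a \<Rightarrow> 'a \<Rightarrow> nat" where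
  "graph_dist G u v = (LEAST n. \<exists>p. pre_digraph.awalk (with_proj G) u p v \<and> length p = n)"

definition graph_diameter :: "'a pair_pre_digraph \<Rightarrow> nat" where
  "graph_diameter G = Max {graph_dist G u v | u v. u \<in> pverts G \<and> v \<in> pverts G}"

text \<open>
  \<open>bs i\<close> and \<open>cs i\<close> are the intersection numbers b_i and c_i. Only their values for \<open>i\<close> up to the
  diameter are determined by \<open>G\<close>.
\<close>

definition distance_regular ::
    "'a pair_pre_digraph \<Rightarrow> (nat \<Rightarrow> nat) \<Rightarrow> (nat \<Rightarrow> nat) \<Rightarrow> bool" where
  "distance_regular G bs cs \<longleftrightarrow>
    pair_graph G \<and> Digraph_Component.connected (with_proj G) \<and>
    (\<forall>u\<in>pverts G. \<forall>v\<in>pverts G.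
      card {w. (v, w) \<in> parcs G \<and> graph_dist G u w = graph_dist G u v + 1} = bs (graph_dist G u v) \<and>
      card {w. (v, w) \<in> parcs G \<and> graph_dist G u w + 1 = graph_dist G u v} = cs (graph_dist G u v))"

definition classical_b :: "nat \<Rightarrow> real \<Rightarrow> real \<Rightarrow> real \<Rightarrow> nat \<Rightarrow> real" where
  "classical_b d b \<alpha> \<beta> i =
    (gauss_binomial b (int d) 1 - gauss_binomial b (int i) 1)
      * (\<beta> - \<alpha> * gauss_binomial b (int i) 1)"

definition classical_c :: "real \<Rightarrow> real \<Rightarrow> nat \<Rightarrow> real" where
  "classical_c b \<alpha> i =
    gauss_binomial b (int i) 1 * (1 + \<alpha> * gauss_binomial b (int i - 1) 1)"

definition classical_a :: "nat \<Rightarrow> real \<Rightarrow> real \<Rightarrow> real \<Rightarrow> nat \<Rightarrow> real" where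
  "classical_a d b \<alpha> \<beta> i = classical_b d b \<alpha> \<beta> 0 - classical_b d b \<alpha> \<beta> i - classical_c b \<alpha> i"

text \<open>
  For diameter at least 3 it is a theorem that \<open>b\<close> is an integer other than 0 and -1; this is
  therefore not part of the definition.
\<close>

definition has_classical_parameters ::
    "'a pair_pre_digraph \<Rightarrow> nat \<Rightarrow> real \<Rightarrow> real \<Rightarrow> real \<Rightarrow> bool" where
  "has_classical_parameters G d b \<alpha> \<beta> \<longleftrightarrow>
    graph_diameter G = d \<and>
    (\<exists>bs cs. distance_regular G bs cs \<and>
      (\<forall>i\<le>d. real (bs i) = classical_b d b \<alpha> \<beta> i \<and> real (cs i) = classical_c b \<alpha> i))"

definition classical_eigenvalue :: "nat \<Rightarrow> real \<Rightarrow> real \<Rightarrow> real \<Rightarrow> nat \<Rightarrow> real" where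
  "classical_eigenvalue d b \<alpha> \<beta> i =
    gauss_binomial b (int d - int i) 1 * (\<beta> - \<alpha> * gauss_binomial b (int i) 1)
      - gauss_binomial b (int i) 1"

text \<open>The entries P_ij of the eigenmatrix; only those with \<open>i \<le> d\<close> and \<open>j \<le> d\<close> are meaningful.\<close>

fun eigenmatrix :: "nat \<Rightarrow> real \<Rightarrow> real \<Rightarrow> real \<Rightarrow> nat \<Rightarrow> nat \<Rightarrow> real" where
  "eigenmatrix d b \<alpha> \<beta> i 0 = 1"
| "eigenmatrix d b \<alpha> \<beta> i (Suc 0) = classical_eigenvalue d b \<alpha> \<beta> i"
| "eigenmatrix d b \<alpha> \<beta> i (Suc (Suc j)) =
    ((classical_eigenvalue d b \<alpha> \<beta> i - classical_a d b \<alpha> \<beta> (Suc j)) * eigenmatrix d b \<alpha> \<beta> i (Suc j)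
      - classical_b d b \<alpha> \<beta> j * eigenmatrix d b \<alpha> \<beta> i j) / classical_c b \<alpha> (Suc (Suc j))"

end

theory Submission
  imports Defs
begin

text \<open>
  For \<open>i = d\<close> the eigenvalue is \<open>-[d]\<close>, and the three-term recurrence then collapses to the
  two-term recurrence \<open>P_{d,j+1} [j+1] = - P_{dj} ([d] - [j])\<close>, whose solution is the claimed
  product because \<open>[d] - [j] = b^j [d-j]\<close>. The divisions are legitimate since, for
  \<open>1 \<le> j \<le> d\<close>, the number \<open>c_j\<close> counts the neighbours preceding a vertex at distance \<open>j\<close> from a
  fixed vertex, and such vertices exist along a geodesic of length \<open>d\<close>; hence \<open>c_j \<noteq> 0\<close> and so
  \<open>[j] \<noteq> 0\<close>.
\<close>

lemma gauss_binomial_one_right: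
  "gauss_binomial b n 1 = (if b = 1 then of_int n else (b powi n - 1) / (b - 1))"
  by (simp add: gauss_binomial_def)

lemma gauss_binomial_zero_one [simp]: "gauss_binomial b 0 1 = 0"
  by (simp add: gauss_binomial_one_right)

lemma gauss_binomial_one_one [simp]: "gauss_binomial b 1 1 = 1"
  by (simp add: gauss_binomial_one_right)

lemma gauss_binomial_zero_right [simp]: "gauss_binomial b n 0 = 1"
  by (simp add: gauss_binomial_def)

text \<open>For \<open>b = 1\<close> this is the absorption identity for binomial coefficients.
  Otherwise both sides have the same factors; as \<open>x / 0 = 0\<close>, this needs no assumption
  that the denominators are nonzero.\<close>

lemma gauss_binomial_Suc:
  "gauss_binomial b n (int (Suc m)) =
    gauss_binomial b n (int m) * (gauss_binomial b (n - int m) 1 / gauss_binomial b (int (Suc m)) 1)"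
proof (cases "b = 1")
  case True
  have "of_int n * (of_int n gchoose m) =
      real m * (of_int n gchoose m) + real (Suc m) * (of_int n gchoose Suc m)"
    by (rule gbinomial_mult_1)
  then have "(of_int n gchoose Suc m) = (of_int n gchoose m) * ((of_int n - real m) / real (Suc m))"
    by (simp add: field_simps)
  then show ?thesis
    using True by (simp add: gauss_binomial_def nat_add_distrib)
next
  case False
  have num: "(\<Prod>h<Suc m. b powi (n - int h) - 1) =
      (\<Prod>h<m. b powi (n - int h) - 1) * (b powi (n - int m) - 1)"
    by simp
  \<comment> \<open>The upper index grows with \<open>m\<close> here, so the new factor sits at
    \<open>h = 0\<close> and not at the end as in \<open>num\<close>.\<close>
  have den: "(\<Prod>h<Suc m. b powi (int (Suc m) - int h) - 1) =
      (b powi int (Suc m) - 1) * (\<Prod>h<m. b powi (int m - int h) - 1)"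
    by (subst prod.lessThan_Suc_shift) simp
  have prods: "gauss_binomial b n (int k) =
      (\<Prod>h<k. b powi (n - int h) - 1) / (\<Prod>h<k. b powi (int k - int h) - 1)" for k
    using False by (simp add: gauss_binomial_def prod_dividef)
  have "gauss_binomial b (n - int m) 1 / gauss_binomial b (int (Suc m)) 1 =
      (b powi (n - int m) - 1) / (b powi int (Suc m) - 1)"
    using False by (simp add: gauss_binomial_one_right)
  then show ?thesis
    unfolding prods num den by simp
qed

lemma gauss_binomial_one_diff:
  assumes "j \<le> d"
  shows "gauss_binomial b (int d) 1 - gauss_binomial b (int j) 1 =
    b ^ j * gauss_binomial b (int d - int j) 1"
proof -
  \<comment> \<open>Natural exponents add without the condition \<open>b \<noteq> 0\<close> that
    negative powers would require.\<close>
  have "b powi (int d - int j) = b ^ (d - j)"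
    using assms by (metis of_nat_diff power_int_of_nat)
  moreover have "b ^ d = b ^ j * b ^ (d - j)"
    using assms by (simp flip: power_add)
  ultimately show ?thesis
    by (simp add: gauss_binomial_one_right diff_divide_distrib right_diff_distrib)
qed

lemma distance_regular_awalk:
  assumes "distance_regular G bs cs" "u \<in> pverts G" "v \<in> pverts G"
  shows "\<exists>p. pre_digraph.awalk (with_proj G) u p v"
proof -
  interpret pair_graph G
    using assms(1) by (simp add: distance_regular_def)
  \<comment> \<open>\<open>connected\<close> ignores the direction of arcs; the symmetry of
    \<open>G\<close> turns it into the existence of directed walks.\<close>
  have "strongly_connected (with_proj G)"
    using assms(1) symmetric_connected_imp_strongly_connected pair_sym_arcs
    by (simp add: distance_regular_def)
  then have "u \<rightarrow>\<^sup>*\<^bsub>with_proj G\<^esub> v"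
    using assms(2,3) by (auto simp: strongly_connected_def)
  then show ?thesis
    by (simp add: reachable_awalk)
qed

text \<open>\<open>LEAST\<close> is attained only over a nonempty set, hence the assumption that
  some walk exists.\<close>

lemma graph_dist_awalk:
  assumes "pre_digraph.awalk (with_proj G) u p v"
  obtains q where "pre_digraph.awalk (with_proj G) u q v" "length q = graph_dist G u v"
  using LeastI_ex[of "\<lambda>n. \<exists>p. pre_digraph.awalk (with_proj G) u p v \<and> length p = n"] assms that
  unfolding graph_dist_def by blast

lemma graph_dist_le:
  "pre_digraph.awalk (with_proj G) u p v \<Longrightarrow> graph_dist G u v \<le> length p"
  unfolding graph_dist_def by (rule Least_le) blast

text \<open>The vertex sought is the last but one on a shortest walk from \<open>u\<close> to
  \<open>v\<close>.\<close>

lemma graph_dist_predecessor: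
  assumes dr: "distance_regular G bs cs" and u: "u \<in> pverts G" and v: "v \<in> pverts G"
    and dist: "graph_dist G u v = Suc n"
  obtains w where "w \<in> pverts G" "(v, w) \<in> parcs G" "graph_dist G u w = n"
proof -
  interpret pair_graph G
    using dr by (simp add: distance_regular_def)
  obtain p where p: "awalk u p v" "length p = Suc n"
    using distance_regular_awalk[OF dr u v] graph_dist_awalk dist by metis
  obtain q e where qe: "p = q @ [e]" "length q = n"
    using p(2) by (auto simp: length_Suc_conv_rev)
  obtain w where q: "awalk u q w" and e: "awalk w [e] v"
    using p(1) qe(1) by auto
  have wv: "(w, v) \<in> parcs G" and w: "w \<in> pverts G"
    using e by (auto simp: awalk_simps)
  obtain q' where q': "awalk u q' w" "length q' = graph_dist G u w"
    using graph_dist_awalk[OF q] .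
  \<comment> \<open>A shorter way to \<open>w\<close>, prolonged by the arc to \<open>v\<close>,
    would beat the distance of \<open>v\<close>.\<close>
  have "Suc n \<le> Suc (graph_dist G u w)"
    using graph_dist_le[OF awalk_appendI[OF q'(1) e]] q'(2) dist by simp
  moreover have "graph_dist G u w \<le> n"
    using graph_dist_le[OF q] qe(2) by simp
  ultimately show thesis
    using that[OF w arcs_symmetric[OF wv]] by simp
qed

lemma distance_regular_c_nonzero:
  assumes dr: "distance_regular G bs cs" and j: "0 < j" "j \<le> graph_diameter G"
  shows "cs j \<noteq> 0"
proof -
  interpret pair_graph G
    using dr by (simp add: distance_regular_def)
  let ?D = "{graph_dist G u v | u v. u \<in> pverts G \<and> v \<in> pverts G}"
  have D: "?D = (\<lambda>(u, v). graph_dist G u v) ` (pverts G \<times> pverts G)"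
    by auto
  have "pverts G \<noteq> {}"
    using dr by (auto simp: distance_regular_def Digraph_Component.connected_def
        strongly_connected_def)
  then have "graph_diameter G \<in> ?D"
    unfolding graph_diameter_def by (intro Max_in) (auto simp: D)
  then obtain u where u: "u \<in> pverts G"
      and far: "\<exists>v\<in>pverts G. graph_dist G u v = graph_diameter G"
    by fastforce
  \<comment> \<open>Downward induction from the diameter, with \<open>u\<close> fixed and each step
    passing to a predecessor.\<close>
  have "\<exists>v\<in>pverts G. graph_dist G u v = j"
    using j(2)
  proof (induction rule: inc_induct)
    case base
    show ?case by (rule far)
  next
    case (step n)
    then show ?case
      using graph_dist_predecessor[OF dr u] by metis
  qed
  then obtain v where v: "v \<in> pverts G" "graph_dist G u v = j"
    by blast
  let ?C = "{w. (v, w) \<in> parcs G \<and> graph_dist G u w + 1 = graph_dist G u v}"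
  obtain w where "(v, w) \<in> parcs G" "graph_dist G u w = j - 1"
    using graph_dist_predecessor[OF dr u v(1), of "j - 1"] j(1) v(2) by auto
  then have "w \<in> ?C"
    using j(1) v(2) by simp
  \<comment> \<open>An infinite set would have \<open>card\<close> 0, so a member alone does not
    suffice.\<close>
  moreover have "finite ?C"
    by (rule finite_subset[of _ "snd ` parcs G"]) force+
  ultimately have "card ?C \<noteq> 0"
    by auto
  moreover have "card ?C = cs (graph_dist G u v)"
    using dr u v(1) unfolding distance_regular_def by blast
  ultimately show ?thesis
    using v(2) by simp
qed

lemma classical_c_nonzero:
  assumes "has_classical_parameters G d b \<alpha> \<beta>" "0 < j" "j \<le> d"
  shows "classical_c b \<alpha> j \<noteq> 0"
  using assms distance_regular_c_nonzero unfolding has_classical_parameters_def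
  by (metis of_nat_eq_0_iff)

lemma classical_eigenvalue_last:
  "classical_eigenvalue d b \<alpha> \<beta> d = - gauss_binomial b (int d) 1"
  by (simp add: classical_eigenvalue_def)

text \<open>The relation for \<open>j\<close> rewrites the \<open>P_{dj}\<close> term of the
  recurrence as a multiple of \<open>P_{d,j+1}\<close>, so that only two consecutive entries
  remain.\<close>

lemma eigenmatrix_last_row_Suc:
  assumes nz: "\<And>i. 0 < i \<Longrightarrow> i \<le> d \<Longrightarrow> classical_c b \<alpha> i \<noteq> 0"
    and "Suc j \<le> d"
  shows "eigenmatrix d b \<alpha> \<beta> d (Suc j) * gauss_binomial b (int (Suc j)) 1 =
    - eigenmatrix d b \<alpha> \<beta> d j * (gauss_binomial b (int d) 1 - gauss_binomial b (int j) 1)"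
  using assms(2)
proof (induction j)
  case 0
  show ?case
    by (simp add: classical_eigenvalue_last)
next
  case (Suc j)
  define D where "D = gauss_binomial b (int d) 1"
  define x where "x = gauss_binomial b (int j) 1"
  define y where "y = gauss_binomial b (int (Suc j)) 1"
  define z where "z = gauss_binomial b (int (Suc (Suc j))) 1"
  define p where "p = eigenmatrix d b \<alpha> \<beta> d j"
  define q where "q = eigenmatrix d b \<alpha> \<beta> d (Suc j)"
  have IH: "q * y = - p * (D - x)"
    using Suc unfolding D_def x_def y_def p_def q_def by simp
  have c: "classical_c b \<alpha> (Suc (Suc j)) = z * (1 + \<alpha> * y)"
    by (simp add: classical_c_def y_def z_def)
  have a: "classical_a d b \<alpha> \<beta> (Suc j) = D * \<beta> - (D - y) * (\<beta> - \<alpha> * y) - y * (1 + \<alpha> * x)"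
    by (simp add: classical_a_def classical_b_def classical_c_def D_def x_def y_def)
  have "classical_b d b \<alpha> \<beta> j * p = (\<beta> - \<alpha> * x) * (p * (D - x))"
    by (simp add: classical_b_def D_def x_def)
  also have "p * (D - x) = - (q * y)"
    using IH by simp
  finally have bp: "classical_b d b \<alpha> \<beta> j * p = - ((\<beta> - \<alpha> * x) * (q * y))"
    by simp
  \<comment> \<open>All terms in \<open>\<beta>\<close> and \<open>x\<close> cancel. The remaining
    factor \<open>1 + \<alpha> * y\<close> also divides \<open>c_{j+2}\<close>, and it can be
    cancelled because \<open>c_{j+2}\<close> is nonzero.\<close>
  have "(- D - classical_a d b \<alpha> \<beta> (Suc j)) * q - classical_b d b \<alpha> \<beta> j * p =
      - q * (D - y) * (1 + \<alpha> * y)"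
    unfolding a bp by (simp add: algebra_simps)
  then have "eigenmatrix d b \<alpha> \<beta> d (Suc (Suc j)) = - q * (D - y) * (1 + \<alpha> * y) / (z * (1 + \<alpha> * y))"
    by (simp add: classical_eigenvalue_last c flip: D_def p_def q_def)
  moreover have "z * (1 + \<alpha> * y) \<noteq> 0"
    using nz[of "Suc (Suc j)"] Suc.prems by (simp add: c)
  ultimately have "eigenmatrix d b \<alpha> \<beta> d (Suc (Suc j)) * z = - q * (D - y)"
    by simp
  then show ?case
    unfolding D_def y_def z_def q_def .
qed

theorem proposition4p1:
  fixes G :: "'a pair_pre_digraph" and d j :: nat and b \<alpha> \<beta> :: real
  assumes "has_classical_parameters G d b \<alpha> \<beta>"
    and "j \<le> d"
  shows "eigenmatrix d b \<alpha> \<beta> d j = (-1) ^ j * gauss_binomial b (int d) (int j) * b ^ (j choose 2)"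
  using assms(2)
proof (induction j)
  case 0
  show ?case
    by (simp add: numeral_2_eq_2)
next
  case (Suc j)
  note nz = classical_c_nonzero[OF assms(1)]
  define y where "y = gauss_binomial b (int (Suc j)) 1"
  have y: "y \<noteq> 0"
    using nz[of "Suc j"] Suc.prems by (auto simp: classical_c_def y_def)
  \<comment> \<open>The exponent grows by \<open>j\<close>, which matches the factor
    \<open>b ^ j\<close> of \<open>[d] - [j]\<close>.\<close>
  have choose: "b ^ (Suc j choose 2) = b ^ (j choose 2) * b ^ j"
    by (simp add: numeral_2_eq_2 power_add)
  have "eigenmatrix d b \<alpha> \<beta> d (Suc j) * y =
      - eigenmatrix d b \<alpha> \<beta> d j * (b ^ j * gauss_binomial b (int d - int j) 1)"
    using eigenmatrix_last_row_Suc[OF nz Suc.prems] gauss_binomial_one_diff[of j d b] Suc.prems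
    by (simp add: y_def)
  also have "\<dots> = (- 1) ^ Suc j * (gauss_binomial b (int d) (int j) * gauss_binomial b (int d - int j) 1)
      * b ^ (Suc j choose 2)"
    using Suc by (simp add: choose)
  also have "gauss_binomial b (int d) (int j) * gauss_binomial b (int d - int j) 1 =
      gauss_binomial b (int d) (int (Suc j)) * y"
    unfolding gauss_binomial_Suc using y by (simp add: y_def)
  finally have "eigenmatrix d b \<alpha> \<beta> d (Suc j) * y =
      ((- 1) ^ Suc j * gauss_binomial b (int d) (int (Suc j)) * b ^ (Suc j choose 2)) * y"
    by (simp only: mult_ac)
  then show ?case
    unfolding mult_right_cancel[OF y] .
qed

end
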